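(* Let $K\ge 1$, $\mathcal K=\{1,\dots,K\}$, let $\mathcal N\subseteq\mathcal K$ be the set of indices of true null hypotheses, $K_0=|\mathcal N|$, and let $E_1,\dots,E_K$ be $[0,\infty]$-valued random variables (e-values), with an arbitrary joint distribution, such that $E_k$ is an e-variable, i.e. $\mathbb E[E_k]\le 1$, for every $k\in\mathcal N$. Let $\alpha\in(0,1)$ and let $\mathcal D$ be the e-BH procedure at level $\alpha$ applied to $(E_1,\dots,E_K)$. Then $$\mathrm{FDR}_{\mathcal D}=\mathbb E\left[\frac{F_{\mathcal D}}{R_{\mathcal D}\vee 1}\right]\le\frac{\alpha K_0}{K}.$$
   Context: Hypotheses $H_1,\dots,H_K$ are tested; $\mathcal N\subseteq\mathcal K$ is the (deterministic) set of indices of the true null hypotheses, and $E_k$ is the e-value associated with $H_k$. An e-variable is a $[0,\infty]$-valued random variable $E$ with $\mathbb E[E]\le 1$. The e-values with $k\notin\mathcal N$ need not be e-variables. An e-testing procedure is a map $\mathcal D:[0,\infty]^K\to 2^{\mathcal K}$ that takes the e-values as input and returns the set of indices of rejected hypotheses; $\mathcal D$ is identified with its random output $\mathcal D(E_1,\dots,E_K)$. $R_{\mathcal D}=|\mathcal D|$ is the number of discoveries and $F_{\mathcal D}=|\mathcal D\cap\mathcal N|$ is the number of false discoveries. The false discovery rate is $\mathrm{FDR}_{\mathcal D}=\mathbb E[F_{\mathcal D}/(R_{\mathcal D}\vee 1)]$; here $x\vee y=\max(x,y)$. e-BH procedure at level $\alpha$: for input $(e_1,\dots,e_K)$ let $e_{[1]}\ge\dots\ge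 e_{[K]}$ be the order statistics from largest to smallest and let $$k^*=\max\left\{k\in\mathcal K:\frac{k e_{[k]}}{K}\ge\frac1\alpha\right\},\qquad \max(\varnothing)=0.$$ The procedure rejects the hypotheses with the $k^*$ largest e-values, i.e. the output is $\{k\in\mathcal K: e_k\ge e_{[k^*]}\}$ if $k^*\ge 1$ and $\varnothing$ if $k^*=0$ (by maximality of $k^*$ there is no tie between $e_{[k^*]}$ and $e_{[k^*+1]}$). *)

theory Defs
  imports "HOL-Probability.Probability"
begin

text \<open>
  An input \<open>e \<in> [0, \<infinity>]\<^sup>K\<close> is a function \<open>e :: nat \<Rightarrow> ennreal\<close> of which only the values on
  \<open>{1..K}\<close> matter, and a testing procedure is a map from such functions to sets of indices.
  Arithmetic takes place in \<^typ>\<open>ennreal\<close>, so e-values equal to \<open>\<infinity>\<close> are covered.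
\<close>

definition e_variable :: "'a measure \<Rightarrow> ('a \<Rightarrow> ennreal) \<Rightarrow> bool" where
  "e_variable M X \<longleftrightarrow> X \<in> borel_measurable M \<and> (\<integral>\<^sup>+ \<omega>. X \<omega> \<partial>M) \<le> 1"

text \<open>The \<open>k\<close>-th largest of \<open>e 1, \<dots>, e K\<close>, counted with multiplicity; meaningful for \<open>1 \<le> k \<le> K\<close>.\<close>

definition order_stat :: "nat \<Rightarrow> (nat \<Rightarrow> ennreal) \<Rightarrow> nat \<Rightarrow> ennreal" where
  "order_stat K e k = rev (sort (map e [1..<Suc K])) ! (k - 1)"

definition eBH_count :: "nat \<Rightarrow> real \<Rightarrow> (nat \<Rightarrow> ennreal) \<Rightarrow> nat" where
  "eBH_count K \<alpha> e =
     (let S = {k \<in> {1..K}. of_nat k * order_stat K e k / of_nat K \<ge> ennreal (1 / \<alpha>)}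
      in if S = {} then 0 else Max S)"

definition eBH :: "nat \<Rightarrow> real \<Rightarrow> (nat \<Rightarrow> ennreal) \<Rightarrow> nat set" where
  "eBH K \<alpha> e =
     (if eBH_count K \<alpha> e = 0 then {}
      else {k \<in> {1..K}. e k \<ge> order_stat K e (eBH_count K \<alpha> e)})"

definition discoveries :: "((nat \<Rightarrow> ennreal) \<Rightarrow> nat set) \<Rightarrow> (nat \<Rightarrow> ennreal) \<Rightarrow> nat" where
  "discoveries D e = card (D e)"

definition false_discoveries ::
    "nat set \<Rightarrow> ((nat \<Rightarrow> ennreal) \<Rightarrow> nat set) \<Rightarrow> (nat \<Rightarrow> ennreal) \<Rightarrow> nat" where
  "false_discoveries N D e = card (D e \<inter> N)"

text \<open>
  The integrand is nonnegative, so the expectation is taken as a nonnegative integral, as for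
  e-variables. This avoids the default value 0 of the Bochner integral.
\<close>

definition FDR ::
    "'a measure \<Rightarrow> nat set \<Rightarrow> ((nat \<Rightarrow> ennreal) \<Rightarrow> nat set) \<Rightarrow> (nat \<Rightarrow> 'a \<Rightarrow> ennreal) \<Rightarrow> ennreal" where
  "FDR M N D E =
     (\<integral>\<^sup>+ \<omega>. ennreal (real (false_discoveries N D (\<lambda>k. E k \<omega>)) /
                    real (max (discoveries D (\<lambda>k. E k \<omega>)) 1)) \<partial>M)"

end

theory Submission
  imports Defs
begin

text \<open>
  The key inequality holds pointwise, and after it only linearity of expectation is used; hence
  the bound is valid under arbitrary dependence between the e-values.
  Suppose that e-BH makes \<open>R\<close> discoveries. Every rejected \<open>k\<close> has \<open>e k \<ge> K / (\<alpha> * R)\<close>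
  (\<open>eBH_self_consistent\<close>), which says that its share \<open>1 / R\<close> of the false discovery proportion is
  at most \<open>\<alpha> / K * e k\<close>. Adding up these shares over the rejected true nulls and discarding the
  condition of being rejected bounds the false discovery proportion by \<open>\<alpha> / K\<close> times the sum of
  the e-values of all true nulls (\<open>eBH_false_discovery_proportion_le\<close>). Each of these e-values
  has expectation at most 1, so taking expectations gives the result.
\<close>

text \<open>
  In the decreasingly sorted list, the first \<open>k\<close> entries are all at least as large as the \<open>k\<close>-th.
  With ties there may be more than \<open>k\<close> such entries.
\<close>

lemma card_ge_order_stat:
  assumes "1 \<le> k" "k \<le> K"
  shows "k \<le> card {j \<in> {1..K}. order_stat K e k \<le> e j}"
proof -
  define c where "c = order_stat K e k"
  define ys where "ys = rev (sort (map e [1..<Suc K]))"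
  have len: "length ys = K"
    by (simp add: ys_def)
  have c: "c = ys ! (k - 1)"
    by (simp add: c_def ys_def order_stat_def)
  have sorted_ys: "sorted_wrt (\<ge>) ys"
    by (simp add: ys_def sorted_wrt_rev)
  have "c \<le> y" if y: "y \<in> set (take k ys)" for y
  proof -
    obtain i where i: "i < k" "i < length ys" "y = ys ! i"
      using y by (auto simp: in_set_conv_nth)
    show "c \<le> y"
    proof (cases "i = k - 1")
      case False
      then have "i < k - 1" "k - 1 < length ys"
        using i len assms by auto
      then show ?thesis
        using sorted_wrt_nth_less[OF sorted_ys] c i(3) by blast
    qed (simp add: c i)
  qed
  then have "filter ((\<le>) c) (take k ys) = take k ys"
    by (simp add: filter_id_conv)
  then have "length (filter ((\<le>) c) ys) \<ge> length (take k ys)"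
    by (metis append_take_drop_id filter_append le_add1 length_append)
  then have "k \<le> length (filter ((\<le>) c) ys)"
    using len assms by simp
  also have "\<dots> = size (filter_mset ((\<le>) c) (mset ys))"
    by (simp flip: mset_filter)
  also have "mset ys = mset (map e [1..<Suc K])"
    by (simp only: ys_def mset_rev mset_sort)
  also have "size (filter_mset ((\<le>) c) \<dots>) = length (filter (\<lambda>j. c \<le> e j) [1..<Suc K])"
    by (simp only: mset_filter[symmetric] size_mset filter_map length_map comp_def)
  also have "\<dots> = card (set (filter (\<lambda>j. c \<le> e j) [1..<Suc K]))"
    by (rule distinct_card[symmetric]) simp
  also have "set (filter (\<lambda>j. c \<le> e j) [1..<Suc K]) = {j \<in> {1..K}. c \<le> e j}"
    by auto
  finally show ?thesis
    by (simp add: c_def)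
qed

text \<open>
  The threshold of e-BH guarantees the bound with the count \<open>k\<^sup>*\<close> in place of the number of
  discoveries. Since at least \<open>k\<^sup>*\<close> hypotheses are rejected, passing to the number of discoveries
  only decreases the left-hand side.
\<close>

lemma eBH_self_consistent:
  assumes "0 < \<alpha>" and k: "k \<in> eBH K \<alpha> e"
  shows "ennreal (1 / real (card (eBH K \<alpha> e))) \<le> ennreal (\<alpha> / real K) * e k"
proof -
  define m where "m = eBH_count K \<alpha> e"
  have "m \<noteq> 0"
    using k by (auto simp: eBH_def m_def split: if_splits)
  define S where
    "S = {k \<in> {1..K}. of_nat k * order_stat K e k / of_nat K \<ge> ennreal (1 / \<alpha>)}"
  have "m = (if S = {} then 0 else Max S)"
    unfolding m_def eBH_count_def S_def Let_def ..
  moreover have "finite S"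
    by (simp add: S_def)
  ultimately have "m \<in> S"
    using \<open>m \<noteq> 0\<close> Max_in[of S] by presburger
  then have m: "1 \<le> m" "m \<le> K"
    and threshold: "ennreal (1 / \<alpha>) \<le> of_nat m * order_stat K e m / of_nat K"
    by (auto simp: S_def)
  have eBH_eq: "eBH K \<alpha> e = {k \<in> {1..K}. order_stat K e m \<le> e k}"
    using \<open>m \<noteq> 0\<close> by (simp add: eBH_def m_def)
  have card: "m \<le> card (eBH K \<alpha> e)"
    unfolding eBH_eq using m by (rule card_ge_order_stat)
  have ek: "order_stat K e m \<le> e k"
    using k eBH_eq by auto
  have "ennreal (1 / real (card (eBH K \<alpha> e))) \<le> ennreal (1 / real m)"
    using card m by (intro ennreal_leI divide_left_mono) auto
  also have "\<dots> = ennreal (\<alpha> / real m) * ennreal (1 / \<alpha>)"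
    using assms m by (simp flip: ennreal_mult)
  also have "\<dots> \<le> ennreal (\<alpha> / real m) * (of_nat m * e k / of_nat K)"
    using ek by (intro mult_left_mono order_trans[OF threshold] divide_right_mono_ennreal) auto
  also have "\<dots> = ennreal (\<alpha> / real m) * ennreal (real m) * ennreal (1 / real K) * e k"
  proof -
    have "x / of_nat K = x * ennreal (1 / real K)" for x :: ennreal
      using m by (simp add: divide_ennreal_def ennreal_of_nat_eq_real_of_nat inverse_ennreal
          inverse_eq_divide)
    then show ?thesis
      by (simp add: ennreal_of_nat_eq_real_of_nat mult_ac)
  qed
  also have "ennreal (\<alpha> / real m) * ennreal (real m) * ennreal (1 / real K) = ennreal (\<alpha> / real K)"
    using assms m by (simp flip: ennreal_mult)
  finally show ?thesis .
qed

lemma eBH_false_discovery_proportion_le: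
  assumes "0 < \<alpha>" "finite N"
  shows "ennreal (real (false_discoveries N (eBH K \<alpha>) e) / real (max (discoveries (eBH K \<alpha>) e) 1))
    \<le> (\<Sum>k\<in>N. ennreal (\<alpha> / real K) * e k)"
proof (cases "eBH K \<alpha> e = {}")
  case True
  then show ?thesis
    by (simp add: false_discoveries_def)
next
  case False
  let ?D = "eBH K \<alpha> e"
  have "finite ?D"
    by (simp add: eBH_def)
  with False have "1 \<le> card ?D"
    by (simp add: Suc_le_eq card_gt_0_iff)
  then have "ennreal (real (false_discoveries N (eBH K \<alpha>) e) / real (max (discoveries (eBH K \<alpha>) e) 1))
      = ennreal (\<Sum>k\<in>?D \<inter> N. 1 / real (card ?D))"
    by (simp add: false_discoveries_def discoveries_def max_absorb1)
  also have "\<dots> = (\<Sum>k\<in>?D \<inter> N. ennreal (1 / real (card ?D)))"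
    by (rule sum_ennreal[symmetric]) simp
  also have "\<dots> \<le> (\<Sum>k\<in>?D \<inter> N. ennreal (\<alpha> / real K) * e k)"
    using assms by (intro sum_mono eBH_self_consistent) auto
  also have "\<dots> \<le> (\<Sum>k\<in>N. ennreal (\<alpha> / real K) * e k)"
    using assms by (intro sum_mono2) auto
  finally show ?thesis .
qed

theorem theorem3:
  fixes M :: "'a measure" and K :: nat and N :: "nat set"
    and E :: "nat \<Rightarrow> 'a \<Rightarrow> ennreal" and \<alpha> :: real
  assumes "prob_space M"
    and "K \<ge> 1"
    and "N \<subseteq> {1..K}"
    and "\<And>k. k \<in> {1..K} \<Longrightarrow> E k \<in> borel_measurable M"
    and "\<And>k. k \<in> N \<Longrightarrow> e_variable M (E k)"
    and "0 < \<alpha>" and "\<alpha> < 1"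
  shows "FDR M N (eBH K \<alpha>) E \<le> ennreal (\<alpha> * real (card N) / real K)"
proof -
  let ?c = "ennreal (\<alpha> / real K)"
  have "finite N"
    using assms(3) by (rule finite_subset) simp
  have meas: "E k \<in> borel_measurable M" and expect: "(\<integral>\<^sup>+ \<omega>. E k \<omega> \<partial>M) \<le> 1" if "k \<in> N" for k
    using assms(5)[OF that] by (auto simp: e_variable_def)
  have "FDR M N (eBH K \<alpha>) E \<le> (\<integral>\<^sup>+ \<omega>. (\<Sum>k\<in>N. ?c * E k \<omega>) \<partial>M)"
    unfolding FDR_def
    by (intro nn_integral_mono eBH_false_discovery_proportion_le assms \<open>finite N\<close>)
  also have "\<dots> = (\<Sum>k\<in>N. \<integral>\<^sup>+ \<omega>. ?c * E k \<omega> \<partial>M)"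
    using meas by (intro nn_integral_sum) auto
  also have "\<dots> = (\<Sum>k\<in>N. ?c * (\<integral>\<^sup>+ \<omega>. E k \<omega> \<partial>M))"
    using meas by (intro sum.cong refl nn_integral_cmult)
  also have "\<dots> \<le> (\<Sum>k\<in>N. ?c * 1)"
    using expect by (intro sum_mono mult_left_mono) auto
  also have "\<dots> = ennreal (\<alpha> * real (card N) / real K)"
    using assms(6) by (simp add: ennreal_of_nat_eq_real_of_nat mult_ac flip: ennreal_mult)
  finally show ?thesis .
qed

end
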